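(* Let $n\geq 3$ and let $\mathbb{J}_{n}=\mathrm{circ}(J_{1},J_{2},\ldots ,J_{n})$. Then $$\det (\mathbb{J}_{n})=(1-J_{n+1})^{n-2}(1-J_{n})+2\sum_{k=1}^{n-2}\left[ J_{k}(1-J_{n+1})^{k-1}(2J_{n})^{n-k-1}\right].$$
   Context: The Jacobsthal numbers are defined by $J_0=0$, $J_1=1$, $J_{k}=J_{k-1}+2J_{k-2}$ for $k\ge 2$. For numbers $c_0,\dots,c_{n-1}$, $\mathrm{circ}(c_0,c_1,\ldots,c_{n-1})$ denotes the $n\times n$ circulant matrix whose first row is $(c_0,c_1,\ldots,c_{n-1})$ and each of whose later rows is the cyclic right shift by one of the row above; i.e. the $(i,j)$ entry ($1\le i,j\le n$) is $c_{(j-i)\bmod n}$. In particular $\mathrm{circ}(J_1,\dots,J_n)$ has first row $(J_1,J_2,\dots,J_n)$. *)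

theory Defs
  imports "Jordan_Normal_Form.Determinant"
begin

fun jacobsthal :: "nat \<Rightarrow> int" where
  "jacobsthal 0 = 0"
| "jacobsthal (Suc 0) = 1"
| "jacobsthal (Suc (Suc k)) = jacobsthal (Suc k) + 2 * jacobsthal k"

(* Matrix indices start at 0 here; the entry depends only on j - i, so the formula is the same
   as for indices starting at 1. The difference is taken in the integers, where mod n yields the
   representative in {0..<n}. *)
definition circ :: "'a list \<Rightarrow> 'a mat" where
  "circ cs = mat (length cs) (length cs)
     (\<lambda>(i, j). cs ! nat ((int j - int i) mod int (length cs)))"

end

(* Multiplying the circulant matrix on the left by the upper unitriangular band matrix with
   superdiagonals -1 and -2 applies the Jacobsthal recurrence to its rows: all rows but the last two
   become zero except for 1 - J(n+1) on the diagonal and -2 J(n) next to it, and row n - 2 becomes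
   (2 J(1), ..., 2 J(n-2), 1 - J(n), 0). The last column then vanishes above its final entry 1, and
   deleting it together with the last row leaves a bidiagonal matrix with one full last row,
   whose determinant is evaluated by expanding along the last column. *)
theory Submission
  imports Defs
begin

definition bidiag_last_row :: "'a::zero \<Rightarrow> 'a \<Rightarrow> (nat \<Rightarrow> 'a) \<Rightarrow> nat \<Rightarrow> 'a mat" where
  "bidiag_last_row x y r m = mat (Suc m) (Suc m)
     (\<lambda>(i, j). if i = m then r j else if j = i then x else if j = Suc i then y else 0)"

text \<open>The last column holds only \<open>y\<close> and the corner entry. Removing it with the
  row of \<open>y\<close> leaves the same shape one size smaller, with cofactor sign -1; removing it
  with the last row leaves a triangular matrix with constant diagonal \<open>x\<close>. So the
  determinants satisfy a first-order recursion.\<close>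

lemma det_bidiag_last_row:
  fixes x y :: "'a::comm_ring_1"
  shows "det (bidiag_last_row x y r m) = (\<Sum>j\<le>m. r j * x ^ j * (- y) ^ (m - j))"
proof (induction m)
  case 0
  show ?case by (simp add: bidiag_last_row_def det_single)
next
  case (Suc m)
  let ?A = "bidiag_last_row x y r (Suc m)"
  have A: "?A \<in> carrier_mat (Suc (Suc m)) (Suc (Suc m))"
    by (simp add: bidiag_last_row_def)
  let ?D = "mat_delete ?A (Suc m) (Suc m)"
  have "det ?D = prod_list (diag_mat ?D)"
    by (rule det_upper_triangular[of _ "Suc m"])
       (auto simp: bidiag_last_row_def mat_delete_def upper_triangular_def)
  also have "diag_mat ?D = map (\<lambda>_. x) [0..<Suc m]"
    unfolding diag_mat_def
    by (rule map_cong) (auto simp: bidiag_last_row_def mat_delete_def)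
  finally have corner: "det ?D = x ^ Suc m"
    by (simp add: map_replicate_const del: upt_Suc)
  have minor: "mat_delete ?A m (Suc m) = bidiag_last_row x y r m"
    by (rule eq_matI) (auto simp: bidiag_last_row_def mat_delete_def)
  have "det ?A = (\<Sum>i<Suc (Suc m). ?A $$ (i, Suc m) * cofactor ?A i (Suc m))"
    by (rule laplace_expansion_column[OF A]) simp
  also have "\<dots> = y * cofactor ?A m (Suc m) + r (Suc m) * cofactor ?A (Suc m) (Suc m)"
    by (simp add: bidiag_last_row_def)
  also have "\<dots> = - y * det (bidiag_last_row x y r m) + r (Suc m) * x ^ Suc m"
    by (simp add: cofactor_def minor corner flip: power_Suc)
  also have "\<dots> = (\<Sum>j\<le>Suc m. r j * x ^ j * (- y) ^ (Suc m - j))"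
    unfolding Suc.IH by (simp add: sum_distrib_left Suc_diff_le mult_ac)
  finally show ?case .
qed

definition jacobsthal_band :: "nat \<Rightarrow> int mat" where
  "jacobsthal_band n = mat n n
     (\<lambda>(i, j). (if j = i then 1 else 0) - (if j = i + 1 then 1 else 0)
       - 2 * (if j = i + 2 then 1 else 0))"

lemma det_jacobsthal_band: "det (jacobsthal_band n) = 1"
proof -
  have "det (jacobsthal_band n) = prod_list (diag_mat (jacobsthal_band n))"
    by (rule det_upper_triangular[of _ n]) (auto simp: jacobsthal_band_def)
  also have "diag_mat (jacobsthal_band n) = map (\<lambda>_. 1) [0..<n]"
    unfolding diag_mat_def by (rule map_cong) (auto simp: jacobsthal_band_def)
  finally show ?thesis by (simp add: map_replicate_const)
qed

lemma jacobsthal_band_mult_entry: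
  assumes "A \<in> carrier_mat n n" "i < n" "j < n"
  shows "(jacobsthal_band n * A) $$ (i, j) =
    A $$ (i, j) - (if i + 1 < n then A $$ (i + 1, j) else 0)
    - 2 * (if i + 2 < n then A $$ (i + 2, j) else 0)"
proof -
  have "(jacobsthal_band n * A) $$ (i, j) =
      (\<Sum>k = 0..<n. (if k = i then A $$ (k, j) else 0) - (if k = i + 1 then A $$ (k, j) else 0)
        - 2 * (if k = i + 2 then A $$ (k, j) else 0))"
    using assms by (auto simp: jacobsthal_band_def scalar_prod_def intro!: sum.cong)
  then show ?thesis
    using assms by (simp add: sum_subtractf flip: sum_distrib_left)
qed

text \<open>Below the diagonal the residue of \<open>j - i\<close> is \<open>n + j - i\<close>; the
  extra 1 arises because the list starts at \<open>jacobsthal 1\<close>.\<close>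

lemma circ_jacobsthal_entry:
  assumes "i < n" "j < n"
  shows "circ (map jacobsthal [1..<n + 1]) $$ (i, j) =
    jacobsthal (if i \<le> j then j + 1 - i else n + j + 1 - i)"
proof (cases "i \<le> j")
  case True
  then have "nat ((int j - int i) mod int n) = j - i"
    using assms by (simp flip: of_nat_diff)
  then show ?thesis
    using assms True by (simp add: circ_def Suc_diff_le del: upt_Suc)
next
  case False
  have "(int j - int i) mod int n = (int j - int i + int n) mod int n"
    by simp
  also have "\<dots> = int (n + j - i)"
    using assms False by (subst mod_pos_pos_trivial) auto
  finally have "nat ((int j - int i) mod int n) = n + j - i"
    by simp
  then show ?thesis
    using assms False by (simp add: circ_def Suc_diff_le del: upt_Suc)
qed

text \<open>This form lets the recurrence apply to indices written with truncated subtraction,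
  leaving their relation to arithmetic.\<close>

lemma jacobsthal_rec:
  assumes "a = b + 1" "b = c + 1"
  shows "jacobsthal a = jacobsthal b + 2 * jacobsthal c"
  using assms by simp

theorem theorem1:
  fixes n :: nat
  assumes "n \<ge> 3"
  shows "det (circ (map jacobsthal [1..<n + 1])) =
    (1 - jacobsthal (n + 1)) ^ (n - 2) * (1 - jacobsthal n)
    + 2 * (\<Sum>k = 1..n - 2.
        jacobsthal k * (1 - jacobsthal (n + 1)) ^ (k - 1) * (2 * jacobsthal n) ^ (n - k - 1))"
proof -
  define m where "m = n - 2"
  then have n: "n = m + 2" using assms by simp
  define C where "C = circ (map jacobsthal [1..<n + 1])"
  define B where "B = jacobsthal_band n * C"
  define x where "x = 1 - jacobsthal (n + 1)"
  define y where "y = - 2 * jacobsthal n"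
  define r where "r j = (if j = m then 1 - jacobsthal n else 2 * jacobsthal (j + 1))" for j
  have C: "C \<in> carrier_mat n n"
    using assms by (simp add: C_def circ_def del: upt_Suc)
  have E: "jacobsthal_band n \<in> carrier_mat n n"
    by (simp add: jacobsthal_band_def)
  have B: "B \<in> carrier_mat n n"
    using E C by (simp add: B_def)
  have detC: "det C = det B"
    by (simp add: B_def det_mult[OF E C] det_jacobsthal_band)
  have entry: "C $$ (i, j) = jacobsthal (if i \<le> j then j + 1 - i else n + j + 1 - i)"
    if "i < n" "j < n" for i j
    unfolding C_def using that by (rule circ_jacobsthal_entry)
  have upper: "B $$ (i, j) = (if j = i then x else if j = i + 1 then y else 0)"
    if "i < m" "j < n" for i j
  proof -
    have *: "B $$ (i, j) = C $$ (i, j) - C $$ (i + 1, j) - 2 * C $$ (i + 2, j)"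
      using jacobsthal_band_mult_entry[OF C, of i j] that by (simp add: B_def n)
    \<comment> \<open>In the outer cases the three entries lie on one side of the wrap-around and
      cancel by the recurrence. The middle cases straddle it: J(1) - J(n) - 2 J(n-1) = 1 - J(n+1)
      and J(2) - J(1) - 2 J(n) = -2 J(n).\<close>
    consider "j < i" | "j = i" | "j = i + 1" | "j \<ge> i + 2" by linarith
    then show ?thesis
    proof cases
      case 1
      have "jacobsthal (n + j + 1 - i) = jacobsthal (n + j - i) + 2 * jacobsthal (n + j - 1 - i)"
        using that n by (intro jacobsthal_rec) auto
      then show ?thesis using 1 that n by (simp add: * entry)
    next
      case 2
      then show ?thesis using * that n by (simp add: entry x_def)
    next
      case 3
      then show ?thesis using * that n by (simp add: entry y_def eval_nat_numeral)
    next
      case 4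
      have "jacobsthal (j + 1 - i) = jacobsthal (j - i) + 2 * jacobsthal (j - 1 - i)"
        using 4 by (intro jacobsthal_rec) auto
      then show ?thesis using 4 that n by (simp add: * entry)
    qed
  qed
  \<comment> \<open>The second band falls outside the matrix here, so for \<open>j < m\<close> the
    difference J(j+3) - J(j+2) = 2 J(j+1) survives; at \<open>j = m\<close> it is J(1) -
    J(n).\<close>
  have full: "B $$ (m, j) = r j" if "j \<le> m" for j
  proof -
    have *: "B $$ (m, j) = C $$ (m, j) - C $$ (m + 1, j)"
      using jacobsthal_band_mult_entry[OF C, of m j] that by (simp add: B_def n)
    show ?thesis
    proof (cases "j = m")
      case True
      then show ?thesis using * n by (simp add: entry r_def)
    next
      case False
      then show ?thesis using that n by (simp add: * entry r_def eval_nat_numeral)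
    qed
  qed
  have corner: "B $$ (m, m + 1) = 0" "B $$ (m + 1, m + 1) = 1"
    using jacobsthal_band_mult_entry[OF C, of m "m + 1"]
      jacobsthal_band_mult_entry[OF C, of "m + 1" "m + 1"]
    by (simp_all add: B_def entry n eval_nat_numeral)
  have minor: "mat_delete B (m + 1) (m + 1) = bidiag_last_row x y r m"
    using B by (intro eq_matI) (auto simp: bidiag_last_row_def mat_delete_def n upper full)
  have "det B = (\<Sum>i<n. B $$ (i, m + 1) * cofactor B i (m + 1))"
    using n by (intro laplace_expansion_column[OF B]) simp
  also have "\<dots> = det (bidiag_last_row x y r m)"
    using corner minor by (simp add: n upper cofactor_def flip: power_add mult_2)
  \<comment> \<open>The term \<open>j = m\<close>, where \<open>r\<close> takes its exceptional
    value, becomes the summand outside the sum.\<close>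
  also have "\<dots> = (\<Sum>j<m. r j * x ^ j * (- y) ^ (m - j)) + r m * x ^ m"
    by (simp add: det_bidiag_last_row lessThan_Suc_atMost[symmetric])
  also have "(\<Sum>j<m. r j * x ^ j * (- y) ^ (m - j)) =
      2 * (\<Sum>j<m. jacobsthal (Suc j) * x ^ j * (2 * jacobsthal n) ^ (m - j))"
    by (simp add: sum_distrib_left r_def y_def mult_ac)
  \<comment> \<open>Substitute \<open>k = j + 1\<close>; since \<open>n = m + 2\<close>, the
    exponent \<open>m - j\<close> is \<open>n - k - 1\<close>.\<close>
  also have "(\<Sum>j<m. jacobsthal (Suc j) * x ^ j * (2 * jacobsthal n) ^ (m - j)) =
      (\<Sum>k = 1..m. jacobsthal k * x ^ (k - 1) * (2 * jacobsthal n) ^ (n - k - 1))"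
    by (rule sum.reindex_bij_witness[of _ "\<lambda>k. k - 1" Suc]) (auto simp: n)
  finally show ?thesis
    using detC by (simp add: C_def x_def r_def n mult.commute)
qed

end
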